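(* Let $n\ge 1$ be an integer and $0<k\le 1$. Consider the pre-commitment rule applied to $n$ i.i.d. uniform draws on $[0,1]$ with thresholds $k_1=\dots=k_{n-1}=k$ and $k_n=0$. Let $PW_k(n,r)$ be the probability that the rule stops at round $r$ and the accepted draw is the overall maximum, and let $PW_k(n)=\sum_{r=1}^{n}PW_k(n,r)$ be the overall win probability. Then for $1\le r\le n$, $$PW_k(n,r)=\frac{k^{\,r-1}}{n-r+1}-\frac{k^{n}}{n-r+1}+\begin{cases}0 & \text{if } 1\le r\le n-1,\\ k^{n}/n & \text{if } r=n,\end{cases}$$ these values are non-negative, and $$PW_k(n)=k^{n}\left(\sum_{r=1}^{n}\frac{1}{(n-r+1)\,k^{\,n-r+1}}-\bigl(\psi^{(0)}(n)+\gamma\bigr)\right),$$ where $\psi^{(0)}$ is the digamma function and $\gamma$ is the Euler--Mascheroni constant.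
   Context: Let $a_1,\dots,a_n$ be i.i.d. uniform random variables on $[0,1]$, observed in sequence. Given a threshold vector $(k_1,\dots,k_n)$ with $k_n=0$ (so the last draw is always accepted), the pre-commitment rule stops at the first round $r$ with $a_r\ge k_r$ and accepts $a_r$, without checking whether $a_r$ is a running maximum. It wins if the accepted draw equals $\max(a_1,\dots,a_n)$. For integer $n\ge1$, $\psi^{(0)}(n)+\gamma=\sum_{m=1}^{n-1}1/m$. *)

theory Defs
  imports "HOL-Probability.Probability"
begin

text \<open>
  Rounds are numbered from 1 to n. A threshold vector is a function t on the rounds, and a
  realisation of the draws is a function x on the rounds. The rule never consults whether a
  draw is a running maximum.
\<close>

definition stops_at :: "nat \<Rightarrow> (nat \<Rightarrow> real) \<Rightarrow> (nat \<Rightarrow> real) \<Rightarrow> nat \<Rightarrow> bool" where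
  "stops_at n t x r \<longleftrightarrow> r \<in> {1..n} \<and> t r \<le> x r \<and> (\<forall>j\<in>{1..<r}. x j < t j)"

definition wins_at :: "nat \<Rightarrow> (nat \<Rightarrow> real) \<Rightarrow> (nat \<Rightarrow> real) \<Rightarrow> nat \<Rightarrow> bool" where
  "wins_at n t x r \<longleftrightarrow> stops_at n t x r \<and> x r = Max (x ` {1..n})"

definition constant_thresholds :: "nat \<Rightarrow> real \<Rightarrow> nat \<Rightarrow> real" where
  "constant_thresholds n k = (\<lambda>i. if i = n then 0 else k)"

definition iid_uniform_draws :: "'a measure \<Rightarrow> nat \<Rightarrow> (nat \<Rightarrow> 'a \<Rightarrow> real) \<Rightarrow> bool" where
  "iid_uniform_draws M n a \<longleftrightarrow>
     prob_space.indep_vars M (\<lambda>_. borel) a {1..n} \<and>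
     (\<forall>i\<in>{1..n}. distr M borel (a i) = uniform_measure lborel {0..1})"

definition PW_round ::
  "'a measure \<Rightarrow> (nat \<Rightarrow> 'a \<Rightarrow> real) \<Rightarrow> real \<Rightarrow> nat \<Rightarrow> nat \<Rightarrow> real" where
  "PW_round M a k n r =
     measure M {\<omega> \<in> space M. wins_at n (constant_thresholds n k) (\<lambda>i. a i \<omega>) r}"

definition PW ::
  "'a measure \<Rightarrow> (nat \<Rightarrow> 'a \<Rightarrow> real) \<Rightarrow> real \<Rightarrow> nat \<Rightarrow> real" where
  "PW M a k n = (\<Sum>r=1..n. PW_round M a k n r)"

end

theory Submission
  imports Defs
begin

text \<open>
  The whole computation rests on conditioning on the value \<open>y\<close> of the accepted draw. The rule wins
  at round \<open>r\<close> exactly when draw \<open>r\<close> reaches its threshold and every other draw \<open>j\<close> is at most \<open>y\<close>,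
  with the extra constraint \<open>x j < k\<close> for the draws before \<open>r\<close>. Given \<open>y\<close>, these are independent
  constraints on the separate coordinates, so Fubini's theorem for the joint law
  (\<open>emeasure_dominant_draw\<close>) turns the win probability into the integral of
  \<open>(min y k)^(r-1) * y^(n-r)\<close> over \<open>y\<close> from \<open>t r\<close> to \<open>1\<close>, where the threshold \<open>t r\<close> is \<open>k\<close>
  for \<open>r < n\<close> and \<open>0\<close> for \<open>r = n\<close>. On \<open>[k,1]\<close> the integrand is
  \<open>k^(r-1) * y^(n-r)\<close>, which gives the first two terms of the formula for every \<open>r\<close>; the last round
  has in addition the piece over \<open>[0,k]\<close>, where the integrand is \<open>y^(n-1)\<close>, and this is the
  term \<open>k^n/n\<close>.

  A realisation stops at no more than one round, so the overall win probability is the sum over the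
  rounds. In that sum the terms \<open>- k^n/(n-r+1)\<close> add up to \<open>- k^n\<close> times the \<open>n\<close>-th harmonic number,
  and the extra \<open>k^n/n\<close> lowers this to the \<open>(n-1)\<close>-st, which is the digamma value at \<open>n\<close> plus
  Euler's constant.
\<close>

section \<open>Conditioning on the dominant draw\<close>

text \<open>
  Conditioning on \<open>X r = y\<close>: the joint law of independent variables is the product of their laws,
  and with coordinate \<open>r\<close> fixed the event is a box in the other coordinates.
\<close>

lemma (in prob_space) emeasure_dominant_draw:
  fixes X :: "'i \<Rightarrow> 'a \<Rightarrow> real" and U :: "real measure"
  assumes J: "finite J" "r \<notin> J"
    and ind: "indep_vars (\<lambda>_. borel) X (insert r J)"
    and law: "\<And>i. i \<in> insert r J \<Longrightarrow> distr M borel (X i) = U"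
    and A: "A \<in> sets borel" and C: "\<And>j. j \<in> J \<Longrightarrow> C j \<in> sets borel"
  shows "emeasure M {\<omega> \<in> space M. X r \<omega> \<in> A \<and> (\<forall>j\<in>J. X j \<omega> \<in> C j \<and> X j \<omega> \<le> X r \<omega>)}
    = (\<integral>\<^sup>+ y. indicator A y * (\<Prod>j\<in>J. emeasure U (C j \<inter> {..y})) \<partial>U)"
proof -
  let ?I = "insert r J"
  have rv: "random_variable borel (X i)" if "i \<in> ?I" for i
    using ind that by (auto simp: indep_vars_def)
  have U: "prob_space U"
    using law[of r] prob_space_distr[OF rv[of r]] by simp
  have sets_U: "sets U = sets borel"
    using law[of r] by auto
  have space_U: "space U = UNIV"
    using sets_eq_imp_space_eq[OF sets_U] by simp
  interpret P: product_sigma_finite "\<lambda>_::'i. U"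
    by (simp add: product_sigma_finite_def U prob_space_imp_sigma_finite)
  let ?P = "\<Pi>\<^sub>M i\<in>?I. U"
  let ?E = "{x \<in> space ?P. x r \<in> A \<and> (\<forall>j\<in>J. x j \<in> C j \<and> x j \<le> x r)}"
  have E: "?E \<in> sets ?P"
  proof -
    have comp: "(\<lambda>x. x i) \<in> borel_measurable ?P" if "i \<in> ?I" for i
      using measurable_component_singleton[OF that, of "\<lambda>_. U"] sets_U
        measurable_cong_sets[OF refl sets_U] by blast
    have mem: "{x \<in> space ?P. x i \<in> B} \<in> sets ?P" if "i \<in> ?I" "B \<in> sets borel" for i B
      using measurable_sets[OF comp[OF that(1)] that(2)] by (simp add: vimage_def Int_def conj_commute)
    show ?thesis
      using J(1) A C
      by (intro sets.sets_Collect_conj sets.sets_Collect_finite_All mem borel_measurable_le comp) auto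
  qed
  let ?X = "\<lambda>\<omega>. \<lambda>i\<in>?I. X i \<omega>"
  have X: "?X \<in> measurable M (\<Pi>\<^sub>M i\<in>?I. borel)"
    using rv by (intro measurable_restrict) auto
  have joint: "distr M (\<Pi>\<^sub>M i\<in>?I. borel) ?X = ?P"
  proof -
    have "distr M (\<Pi>\<^sub>M i\<in>?I. borel) ?X = (\<Pi>\<^sub>M i\<in>?I. distr M borel (X i))"
      using indep_vars_iff_distr_eq_PiM'[where I = ?I and M' = "\<lambda>_. borel" and X = X] rv ind by simp
    also have "\<dots> = ?P"
      by (intro PiM_cong refl law)
    finally show ?thesis .
  qed
  have "emeasure M {\<omega> \<in> space M. X r \<omega> \<in> A \<and> (\<forall>j\<in>J. X j \<omega> \<in> C j \<and> X j \<omega> \<le> X r \<omega>)}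
      = emeasure M (?X -` ?E \<inter> space M)"
    by (intro arg_cong[where f = "emeasure M"])
       (auto simp: space_PiM space_U)
  also have "\<dots> = emeasure (distr M (\<Pi>\<^sub>M i\<in>?I. borel) ?X) ?E"
  proof (rule emeasure_distr[OF X, symmetric])
    show "?E \<in> sets (\<Pi>\<^sub>M i\<in>?I. borel)"
      using E sets_PiM_cong[OF refl, of ?I "\<lambda>_. U" "\<lambda>_. borel"] sets_U by blast
  qed
  also have "\<dots> = emeasure ?P ?E"
    unfolding joint ..
  also have "\<dots> = (\<integral>\<^sup>+ x. indicator ?E x \<partial>?P)"
    by (rule nn_integral_indicator[OF E, symmetric])
  also have "\<dots> = (\<integral>\<^sup>+ y. (\<integral>\<^sup>+ x. indicator ?E (x(r := y)) \<partial>(\<Pi>\<^sub>M i\<in>J. U)) \<partial>U)"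
    using E J by (intro P.product_nn_integral_insert_rev) auto
  also have "\<dots> = (\<integral>\<^sup>+ y. indicator A y * (\<Prod>j\<in>J. emeasure U (C j \<inter> {..y})) \<partial>U)"
  proof (rule nn_integral_cong)
    fix y
    let ?B = "\<Pi>\<^sub>E j\<in>J. C j \<inter> {..y}"
    have box: "C j \<inter> {..y} \<in> sets U" if "j \<in> J" for j
      using C[OF that] sets_U by auto
    have B: "?B \<in> sets (\<Pi>\<^sub>M i\<in>J. U)"
      using J(1) box by (intro sets_PiM_I_finite)
    have "(\<integral>\<^sup>+ x. indicator ?E (x(r := y)) \<partial>(\<Pi>\<^sub>M i\<in>J. U))
        = (\<integral>\<^sup>+ x. indicator A y * indicator ?B x \<partial>(\<Pi>\<^sub>M i\<in>J. U))"
    proof (rule nn_integral_cong)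
      fix x assume "x \<in> space (\<Pi>\<^sub>M i\<in>J. U)"
      then have x: "x \<in> extensional J"
        by (simp add: space_PiM PiE_def)
      have upd: "x(r := y) \<in> space ?P"
        using x by (auto simp: space_PiM space_U PiE_def extensional_def)
      have "(\<forall>j\<in>J. (x(r := y)) j \<in> C j \<and> (x(r := y)) j \<le> y) \<longleftrightarrow> x \<in> ?B"
        using x J(2) by (auto simp: PiE_def Pi_def)
      with upd have "x(r := y) \<in> ?E \<longleftrightarrow> y \<in> A \<and> x \<in> ?B"
        by simp
      then show "indicator ?E (x(r := y)) = indicator A y * (indicator ?B x :: ennreal)"
        by (simp add: indicator_def)
    qed
    also have "\<dots> = indicator A y * emeasure (\<Pi>\<^sub>M i\<in>J. U) ?B"
      using B by (simp add: nn_integral_cmult_indicator)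
    also have "emeasure (\<Pi>\<^sub>M i\<in>J. U) ?B = (\<Prod>j\<in>J. emeasure U (C j \<inter> {..y}))"
      using J(1) box by (intro P.emeasure_PiM) auto
    finally show "(\<integral>\<^sup>+ x. indicator ?E (x(r := y)) \<partial>(\<Pi>\<^sub>M i\<in>J. U))
        = indicator A y * (\<Prod>j\<in>J. emeasure U (C j \<inter> {..y}))" .
  qed
  finally show ?thesis .
qed

section \<open>Uniform draws\<close>

lemma emeasure_uniform_unit_atMost:
  assumes "0 \<le> y" "y \<le> 1"
  shows "emeasure (uniform_measure lborel {0..1::real}) {..y} = ennreal y"
proof -
  have "{0..1} \<inter> {..y} = {0..y}"
    using assms by auto
  then show ?thesis
    using assms by (simp add: divide_ennreal_def)
qed

lemma emeasure_uniform_unit_lessThan_atMost: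
  assumes "0 \<le> y" "y \<le> 1" "0 \<le> k"
  shows "emeasure (uniform_measure lborel {0..1::real}) ({..<k} \<inter> {..y}) = ennreal (min y k)"
proof (cases "y < k")
  case True
  then have "{..<k} \<inter> {..y} = {..y}"
    by auto
  with True show ?thesis
    using assms emeasure_uniform_unit_atMost[of y] by simp
next
  case False
  then have "{0..1} \<inter> ({..<k} \<inter> {..y}) = {0..<k}"
    using assms by auto
  with False show ?thesis
    using assms by (simp add: divide_ennreal_def)
qed

lemma nn_integral_power_Icc:
  fixes a b c :: real
  assumes "0 \<le> a" "a \<le> b" "0 \<le> c"
  shows "(\<integral>\<^sup>+ y. ennreal (c * y ^ m) * indicator {a..b} y \<partial>lborel)
    = ennreal (c * (b ^ Suc m - a ^ Suc m) / real (Suc m))"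
proof -
  have "(\<integral>\<^sup>+ y. ennreal (c * y ^ m) * indicator {a..b} y \<partial>lborel)
      = ennreal (c * b ^ Suc m / real (Suc m) - c * a ^ Suc m / real (Suc m))"
  proof (rule nn_integral_FTC_Icc)
    fix x assume "x \<in> {a..b}"
    have "((\<lambda>x. c * x ^ Suc m / real (Suc m)) has_real_derivative
        c * (real (Suc m) * x ^ m) / real (Suc m)) (at x)"
      by (intro DERIV_cdivide DERIV_cmult) (use DERIV_pow[of "Suc m" x] in simp)
    then show "((\<lambda>x. c * x ^ Suc m / real (Suc m)) has_real_derivative c * x ^ m) (at x)"
      by simp
    show "0 \<le> c * x ^ m"
      using assms \<open>x \<in> {a..b}\<close> by simp
  qed (use assms in auto)
  then show ?thesis
    by (simp add: right_diff_distrib diff_divide_distrib)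
qed

text \<open>
  The integrand is the probability that, given \<open>X r = y\<close>, each of the \<open>r - 1\<close> earlier draws is at
  most \<open>y\<close> and below \<open>k\<close>, and each of the \<open>n - r\<close> later draws is at most \<open>y\<close>. In the last round
  the threshold \<open>0\<close> lets values below \<open>k\<close> win too, hence the additional term.
\<close>

lemma nn_integral_capped_power:
  fixes k :: real
  assumes r: "1 \<le> r" "r \<le> n" and k: "0 < k" "k \<le> 1"
  shows "(\<integral>\<^sup>+ y. ennreal (min y k ^ (r - 1) * y ^ (n - r))
            * indicator {constant_thresholds n k r..1} y \<partial>lborel)
    = ennreal (k ^ (r - 1) / real (n - r + 1) - k ^ n / real (n - r + 1)
              + (if r = n then k ^ n / real n else 0))"
    (is "integral\<^sup>N lborel ?f = _")
proof -
  let ?g = "\<lambda>y. ennreal (k ^ (r - 1) * y ^ (n - r)) * indicator {k..1} y"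
  let ?v = "k ^ (r - 1) * (1 - k ^ Suc (n - r)) / real (Suc (n - r))"
  have g: "(\<integral>\<^sup>+ y. ?g y \<partial>lborel) = ennreal ?v"
    using nn_integral_power_Icc[of k 1 "k ^ (r - 1)" "n - r"] k by simp
  have "r - 1 + Suc (n - r) = n"
    using r by simp
  then have pow: "k ^ (r - 1) * k ^ Suc (n - r) = k ^ n"
    by (metis power_add)
  have v: "?v = k ^ (r - 1) / real (n - r + 1) - k ^ n / real (n - r + 1)"
    unfolding pow[symmetric]
    by (simp only: right_diff_distrib mult_1_right diff_divide_distrib Suc_eq_plus1)
  show ?thesis
  proof (cases "r = n")
    case False
    then have "?f = ?g"
      by (auto simp: constant_thresholds_def indicator_def fun_eq_iff min_def)
    with g v False show ?thesis
      by simp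
  next
    case True
    let ?h = "\<lambda>y. ennreal (1 * y ^ (n - 1)) * indicator {0..k} y"
    have "Suc (n - 1) = n"
      using r by simp
    then have h: "(\<integral>\<^sup>+ y. ?h y \<partial>lborel) = ennreal (k ^ n / real n)"
      using nn_integral_power_Icc[of 0 k 1 "n - 1"] k r by simp
    have "AE y in lborel. y \<noteq> k"
      by (rule AE_lborel_singleton)
    \<comment> \<open>At \<open>y = k\<close> the two pieces overlap, so the splitting only holds almost everywhere.\<close>
    then have "AE y in lborel. ?f y = ?h y + ?g y"
      by eventually_elim
         (use True k in \<open>auto simp: constant_thresholds_def indicator_def min_def\<close>)
    then have "integral\<^sup>N lborel ?f = (\<integral>\<^sup>+ y. ?h y + ?g y \<partial>lborel)"
      by (rule nn_integral_cong_AE)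
    also have "\<dots> = (\<integral>\<^sup>+ y. ?h y \<partial>lborel) + (\<integral>\<^sup>+ y. ?g y \<partial>lborel)"
      by (rule nn_integral_add) auto
    also have "\<dots> = ennreal (k ^ n / real n) + ennreal ?v"
      by (simp only: h g)
    also have "\<dots> = ennreal (k ^ n / real n + ?v)"
      using k by (intro ennreal_plus[symmetric]) (auto simp: power_le_one mult_le_one)
    finally show ?thesis
      unfolding v using True by (simp add: add.commute)
  qed
qed

section \<open>Winning at a given round\<close>

text \<open>
  The rounds before \<open>r\<close> are all before \<open>n\<close>, so their thresholds are \<open>k\<close> even when \<open>r = n\<close>. This puts
  the event into the form of \<open>emeasure_dominant_draw\<close>.
\<close>

lemma wins_at_constant_thresholds_iff:
  assumes "r \<in> {1..n}"
  shows "wins_at n (constant_thresholds n k) x r \<longleftrightarrow>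
    constant_thresholds n k r \<le> x r \<and>
    (\<forall>j\<in>{1..n} - {r}. x j \<in> (if j < r then {..<k} else UNIV) \<and> x j \<le> x r)"
proof -
  have "x r = Max (x ` {1..n}) \<longleftrightarrow> (\<forall>j\<in>{1..n}. x j \<le> x r)"
    using assms by (subst eq_Max_iff) auto
  moreover have "(\<forall>j\<in>{1..<r}. x j < constant_thresholds n k j) \<longleftrightarrow> (\<forall>j\<in>{1..<r}. x j < k)"
    using assms by (auto simp: constant_thresholds_def)
  ultimately show ?thesis
    using assms unfolding wins_at_def stops_at_def by (auto split: if_splits)
qed

lemma stops_at_unique:
  assumes "stops_at n t x r" "stops_at n t x s"
  shows "r = s"
proof (rule ccontr)
  assume "r \<noteq> s"
  then consider "r < s" | "s < r"
    by linarith
  then show False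
    using assms by cases (force simp: stops_at_def)+
qed

context prob_space
begin

lemma wins_at_measurable:
  assumes "iid_uniform_draws M n a"
  shows "{\<omega> \<in> space M. wins_at n (constant_thresholds n k) (\<lambda>i. a i \<omega>) r} \<in> sets M"
proof (cases "r \<in> {1..n}")
  case True
  have rv: "a i \<in> borel_measurable M" if "i \<in> {1..n}" for i
    using assms that by (auto simp: iid_uniform_draws_def indep_vars_def)
  have mem: "{\<omega> \<in> space M. a i \<omega> \<in> B} \<in> sets M" if "i \<in> {1..n}" "B \<in> sets borel" for i B
    using measurable_sets[OF rv[OF that(1)] that(2)] by (simp add: vimage_def Int_def conj_commute)
  show ?thesis
    unfolding wins_at_constant_thresholds_iff[OF True]
      atLeast_iff[of _ "constant_thresholds n k r", symmetric]
    using True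
    by (intro sets.sets_Collect_conj sets.sets_Collect_finite_All mem borel_measurable_le rv) auto
next
  case False
  then have "\<not> wins_at n t x r" for t x
    unfolding wins_at_def stops_at_def by blast
  then show ?thesis
    by simp
qed

lemma PW_round_eq:
  assumes k: "0 < k" "k \<le> 1" and iid: "iid_uniform_draws M n a" and r: "r \<in> {1..n}"
  shows "PW_round M a k n r =
    k ^ (r - 1) / real (n - r + 1) - k ^ n / real (n - r + 1)
      + (if r = n then k ^ n / real n else 0)" (is "_ = ?v")
proof -
  let ?J = "{1..n} - {r}"
  let ?U = "uniform_measure lborel {0..1::real}"
  let ?C = "\<lambda>j. if j < r then {..<k} else UNIV :: real set"
  let ?t = "constant_thresholds n k r"
  let ?W = "{\<omega> \<in> space M. wins_at n (constant_thresholds n k) (\<lambda>i. a i \<omega>) r}"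
  let ?F = "\<lambda>y. indicator {?t..} y * (\<Prod>j\<in>?J. emeasure ?U (?C j \<inter> {..y}))"
  let ?G = "\<lambda>y. ennreal (min y k ^ (r - 1) * y ^ (n - r)) * indicator {?t..} y"
  have J: "insert r ?J = {1..n}"
    using r by auto
  have W: "?W = {\<omega> \<in> space M. a r \<omega> \<in> {?t..} \<and> (\<forall>j\<in>?J. a j \<omega> \<in> ?C j \<and> a j \<omega> \<le> a r \<omega>)}"
    unfolding wins_at_constant_thresholds_iff[OF r] by (simp only: atLeast_iff)
  have "emeasure M ?W = (\<integral>\<^sup>+ y. ?F y \<partial>?U)"
    unfolding W
  proof (rule emeasure_dominant_draw)
    show "indep_vars (\<lambda>_. borel) a (insert r ?J)"
      and "\<And>i. i \<in> insert r ?J \<Longrightarrow> distr M borel (a i) = ?U"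
      using iid unfolding J iid_uniform_draws_def by auto
  qed auto
  also have "\<dots> = (\<integral>\<^sup>+ y. ?G y \<partial>?U)"
  proof (rule nn_integral_cong_AE)
    \<comment> \<open>The draws may leave the unit interval on a null set, where the distribution function of
      the uniform law is not the identity.\<close>
    have "AE y in ?U. y \<in> {0..1}"
      by (rule AE_uniform_measureI) auto
    then show "AE y in ?U. ?F y = ?G y"
    proof eventually_elim
      case (elim y)
      then have y: "0 \<le> y" "y \<le> 1"
        by auto
      have "emeasure ?U (?C j \<inter> {..y}) = ennreal (if j < r then min y k else y)" for j
        using y k emeasure_uniform_unit_atMost[of y]
          emeasure_uniform_unit_lessThan_atMost[of y k] by simp
      then have "(\<Prod>j\<in>?J. emeasure ?U (?C j \<inter> {..y}))
          = ennreal (\<Prod>j\<in>?J. if j < r then min y k else y)"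
        using y k by (simp add: prod_ennreal)
      also have "(\<Prod>j\<in>?J. if j < r then min y k else y)
          = (\<Prod>j\<in>{1..<r}. min y k) * (\<Prod>j\<in>{r<..n}. y)"
      proof -
        have "?J \<inter> {j. j < r} = {1..<r}" "?J \<inter> - {j. j < r} = {r<..n}"
          using r by auto
        then show ?thesis
          by (simp add: prod.If_cases)
      qed
      finally show ?case
        by (simp add: mult.commute)
    qed
  qed
  also have "\<dots> = (\<integral>\<^sup>+ y. ?G y * indicator {0..1} y \<partial>lborel)"
    by (subst nn_integral_uniform_measure) (auto simp: divide_ennreal_def)
  also have "\<dots> = (\<integral>\<^sup>+ y. ennreal (min y k ^ (r - 1) * y ^ (n - r)) * indicator {?t..1} y \<partial>lborel)"
    using k by (intro nn_integral_cong) (auto simp: indicator_def constant_thresholds_def)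
  also have "\<dots> = ennreal ?v"
    using r k by (intro nn_integral_capped_power) auto
  finally have "emeasure M ?W = ennreal ?v" .
  moreover have "0 \<le> ?v"
  proof -
    have "k ^ n \<le> k ^ (r - 1)"
      using k r by (intro power_decreasing) auto
    then show ?thesis
      using k by (simp add: divide_right_mono)
  qed
  ultimately show ?thesis
    by (simp add: PW_round_def measure_def)
qed

lemma PW_eq_measure_Ex:
  assumes "iid_uniform_draws M n a"
  shows "PW M a k n =
    measure M {\<omega> \<in> space M. \<exists>r. wins_at n (constant_thresholds n k) (\<lambda>i. a i \<omega>) r}"
proof -
  let ?W = "\<lambda>r. {\<omega> \<in> space M. wins_at n (constant_thresholds n k) (\<lambda>i. a i \<omega>) r}"
  have "disjoint_family_on ?W {1..n}"
    by (auto simp: disjoint_family_on_def wins_at_def dest: stops_at_unique)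
  then have "measure M (\<Union>r\<in>{1..n}. ?W r) = PW M a k n"
    unfolding PW_def PW_round_def using wins_at_measurable[OF assms]
    by (intro finite_measure_finite_Union) auto
  moreover have "(\<Union>r\<in>{1..n}. ?W r)
      = {\<omega> \<in> space M. \<exists>r. wins_at n (constant_thresholds n k) (\<lambda>i. a i \<omega>) r}"
    by (auto simp: wins_at_def stops_at_def)
  ultimately show ?thesis
    by simp
qed

end

section \<open>Summation over the rounds\<close>

lemma Digamma_of_nat_add_euler_mascheroni:
  assumes "1 \<le> n"
  shows "Digamma (real n) + euler_mascheroni = harm n - 1 / real n"
proof -
  obtain m where m: "n = Suc m"
    using assms by (cases n) auto
  have "Digamma (real (Suc m)) = harm m - euler_mascheroni"
    by (rule Digamma_of_nat)
  then show ?thesis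
    unfolding m by (simp add: harm_Suc inverse_eq_divide)
qed

lemma sum_win_formula:
  fixes k :: real
  assumes n: "1 \<le> n" and k: "0 < k"
  shows "(\<Sum>r=1..n. k ^ (r - 1) / real (n - r + 1) - k ^ n / real (n - r + 1)
              + (if r = n then k ^ n / real n else 0))
    = k ^ n * ((\<Sum>r=1..n. 1 / (real (n - r + 1) * k ^ (n - r + 1)))
               - (Digamma (real n) + euler_mascheroni))"
proof -
  have main: "k ^ (r - 1) / real (n - r + 1) = k ^ n * (1 / (real (n - r + 1) * k ^ (n - r + 1)))"
    if "r \<in> {1..n}" for r
  proof -
    have "n = (r - 1) + (n - r + 1)"
      using that by auto
    then have "k ^ n = k ^ (r - 1) * k ^ (n - r + 1)"
      by (metis power_add)
    then show ?thesis
      using k by simp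
  qed
  have "(\<Sum>r=1..n. 1 / real (n - r + 1)) = (\<Sum>i=1..n. 1 / real i)"
    by (rule sum.reindex_bij_witness[of _ "\<lambda>i. n - i + 1" "\<lambda>r. n - r + 1"]) auto
  also have "\<dots> = harm n"
    by (simp add: harm_def inverse_eq_divide)
  finally have "k ^ n * (\<Sum>r=1..n. 1 / real (n - r + 1)) = k ^ n * harm n"
    by (rule arg_cong)
  then have harm: "(\<Sum>r=1..n. k ^ n / real (n - r + 1)) = k ^ n * harm n"
    by (simp only: sum_distrib_left times_divide_eq_right mult_1_right)
  have "(\<Sum>r=1..n. k ^ (r - 1) / real (n - r + 1) - k ^ n / real (n - r + 1)
              + (if r = n then k ^ n / real n else 0))
      = (\<Sum>r=1..n. k ^ (r - 1) / real (n - r + 1)) - k ^ n * harm n + k ^ n / real n"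
    using n by (simp only: sum.distrib sum_subtractf harm) simp
  also have "(\<Sum>r=1..n. k ^ (r - 1) / real (n - r + 1))
      = k ^ n * (\<Sum>r=1..n. 1 / (real (n - r + 1) * k ^ (n - r + 1)))"
    unfolding sum_distrib_left by (rule sum.cong[OF refl main])
  finally show ?thesis
    unfolding Digamma_of_nat_add_euler_mascheroni[OF n] by (simp only: algebra_simps) simp
qed

theorem mainTheorem2:
  fixes M :: "'a measure" and a :: "nat \<Rightarrow> 'a \<Rightarrow> real" and n :: nat and k :: real
  assumes "prob_space M"
    and "1 \<le> n"
    and "0 < k" and "k \<le> 1"
    and "iid_uniform_draws M n a"
  shows "(\<forall>r\<in>{1..n}.
            PW_round M a k n r =
              k ^ (r - 1) / real (n - r + 1) - k ^ n / real (n - r + 1)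
              + (if r = n then k ^ n / real n else 0)
            \<and> 0 \<le> PW_round M a k n r)
         \<and> PW M a k n =
             measure M {\<omega> \<in> space M. \<exists>r. wins_at n (constant_thresholds n k) (\<lambda>i. a i \<omega>) r}
         \<and> PW M a k n =
             k ^ n * ((\<Sum>r=1..n. 1 / (real (n - r + 1) * k ^ (n - r + 1)))
                      - (Digamma (real n) + euler_mascheroni))"
proof -
  interpret prob_space M by fact
  note round = PW_round_eq[OF assms(3,4,5)]
  have "PW M a k n = (\<Sum>r=1..n. k ^ (r - 1) / real (n - r + 1) - k ^ n / real (n - r + 1)
              + (if r = n then k ^ n / real n else 0))"
    unfolding PW_def by (rule sum.cong[OF refl round])
  also note sum_win_formula[OF assms(2,3)]
  finally have "PW M a k n =
      k ^ n * ((\<Sum>r=1..n. 1 / (real (n - r + 1) * k ^ (n - r + 1)))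
               - (Digamma (real n) + euler_mascheroni))" .
  moreover have "0 \<le> PW_round M a k n r" for r
    by (simp add: PW_round_def)
  ultimately show ?thesis
    using round PW_eq_measure_Ex[OF assms(5)] by blast
qed

end
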